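(* Let $p\in(0,\infty]$, $q\in(0,\infty]$ and let $b$ be a slowly varying function. Suppose that either $p<1$, or that $p=1$ and $b$ is not equivalent to a non-increasing function on $(0,\infty)$. Then the fundamental function $\varphi_X$ of $X=L^{p,q,b}$ satisfies $$\varphi_X(t)\approx t^{1/p}b(t)\quad\text{for } t\in(0,\infty),\qquad \varphi_X(\infty)=\infty .$$ Consequently $\varphi_X$ is not equivalent (on $(0,\infty)$) to any quasi-concave function.
   Context: $(R,\mu)$ is a $\sigma$-finite non-atomic measure space with $\mu(R)=\infty$; $M=M(R,\mu)$ is the set of extended complex-valued $\mu$-measurable functions on $R$. For $f\in M$, $f^*(t)=\inf\{s\ge 0:\mu(\{|f|>s\})\le t\}$. Two non-negative functions $g,h$ are equivalent, $g\approx h$, if there are constants $0<c\le C<\infty$ with $cg\le h\le Cg$. A measurable $b:(0,\infty)\to(0,\infty)$ is slowly varying if for every $\varepsilon>0$ there are a non-decreasing function $b_\varepsilon$ and a non-increasing function $b_{-\varepsilon}$ with $t^\varepsilon b(t)\approx b_\varepsilon(t)$ and $t^{-\varepsilon}b(t)\approx b_{-\varepsilon}(t)$ on $(0,\infty)$. For $f\in M$, $\lVert f\rVert_{p,q,b}=\lVert t^{1/p-1/q}b(t)f^*(t)\rVert_q$ (with $1/\infty=0$), where $\lVert\cdot\rVert_q$ is the Lebesgue $L^q$ (quasi)norm over $(0,\infty)$ in the variable $t$, and $L^{p,q,b}=\{f\in M:\lVert f\rVert_{p,q,b}<\infty\}$. The fundamental function of $X=L^{p,q,b}$ is $\varphi_X(t)=\lVert\chi_E\rVert_{p,q,b}$,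 where $E\subseteq R$ is any measurable set with $\mu(E)=t$, $t\in[0,\infty]$; in particular $\varphi_X(0)=0$. A function $\varphi:[0,\infty)\to[0,\infty)$ is quasi-concave if it is non-decreasing, vanishes only at $0$, and $t\mapsto t/\varphi(t)$ is non-decreasing on $(0,\infty)$. *)

theory Defs
  imports "HOL-Probability.Essential_Supremum"
begin

definition nonatomic :: "'a measure \<Rightarrow> bool" where
  "nonatomic R \<longleftrightarrow>
     (\<forall>A\<in>sets R. 0 < emeasure R A \<longrightarrow>
        (\<exists>B\<in>sets R. B \<subseteq> A \<and> 0 < emeasure R B \<and> emeasure R B < emeasure R A))"

text \<open>Extended complex numbers are modelled by the type \<^typ>\<open>complex option\<close>, with
  \<^const>\<open>None\<close> as the point at infinity.\<close>

fun ext_mod :: "complex option \<Rightarrow> ennreal" where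
  "ext_mod None = \<infinity>"
| "ext_mod (Some z) = ennreal (norm z)"

definition ext_measurable :: "'a measure \<Rightarrow> ('a \<Rightarrow> complex option) set" where
  "ext_measurable R =
     {f. {x \<in> space R. f x = None} \<in> sets R \<and>
         (\<lambda>x. case f x of None \<Rightarrow> 0 | Some z \<Rightarrow> z) \<in> borel_measurable R}"

definition ext_indicator :: "'a set \<Rightarrow> 'a \<Rightarrow> complex option" where
  "ext_indicator E x = Some (indicator E x)"

definition rearrangement :: "'a measure \<Rightarrow> ('a \<Rightarrow> complex option) \<Rightarrow> real \<Rightarrow> ennreal" where
  "rearrangement R f t =
     Inf {ennreal s | s. 0 \<le> s \<and>
            emeasure R {x \<in> space R. ennreal s < ext_mod (f x)} \<le> ennreal t}"

text \<open>Non-negative functions are represented by functions into \<^typ>\<open>ennreal\<close>.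
  A function equivalent to a finite and positive one is itself finite and positive.\<close>

definition equiv_on :: "'a set \<Rightarrow> ('a \<Rightarrow> ennreal) \<Rightarrow> ('a \<Rightarrow> ennreal) \<Rightarrow> bool" where
  "equiv_on S g h \<longleftrightarrow>
     (\<exists>c C::real. 0 < c \<and> c \<le> C \<and>
        (\<forall>t\<in>S. ennreal c * g t \<le> h t \<and> h t \<le> ennreal C * g t))"

definition slowly_varying :: "(real \<Rightarrow> real) \<Rightarrow> bool" where
  "slowly_varying b \<longleftrightarrow>
     b \<in> borel_measurable (lebesgue_on {0<..}) \<and>
     (\<forall>t>0. 0 < b t) \<and>
     (\<forall>\<epsilon>>0.
        (\<exists>g::real \<Rightarrow> ennreal. mono_on {0<..} g \<and>
           equiv_on {0<..} (\<lambda>t. ennreal (t powr \<epsilon> * b t)) g) \<and>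
        (\<exists>h::real \<Rightarrow> ennreal. antimono_on {0<..} h \<and>
           equiv_on {0<..} (\<lambda>t. ennreal (t powr (- \<epsilon>) * b t)) h))"

text \<open>Only used with a positive exponent, hence the value at infinity.\<close>

definition ennreal_powr :: "ennreal \<Rightarrow> real \<Rightarrow> ennreal" where
  "ennreal_powr x r = (if x = \<infinity> then \<infinity> else ennreal (enn2real x powr r))"

definition Lq_norm :: "ennreal \<Rightarrow> (real \<Rightarrow> ennreal) \<Rightarrow> ennreal" where
  "Lq_norm q g =
     (if q = \<infinity> then esssup (lebesgue_on {0<..}) g
      else ennreal_powr (\<integral>\<^sup>+t. ennreal_powr (g t) (enn2real q) \<partial>lebesgue_on {0<..})
             (1 / enn2real q))"

text \<open>The reciprocal of an exponent in \<open>(0,\<infinity>]\<close>, with \<open>1/\<infinity> = 0\<close>.\<close>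

definition recip :: "ennreal \<Rightarrow> real" where
  "recip p = (if p = \<infinity> then 0 else 1 / enn2real p)"

definition LK_norm ::
    "'a measure \<Rightarrow> ennreal \<Rightarrow> ennreal \<Rightarrow> (real \<Rightarrow> real) \<Rightarrow> ('a \<Rightarrow> complex option) \<Rightarrow> ennreal" where
  "LK_norm R p q b f =
     Lq_norm q (\<lambda>t. ennreal (t powr (recip p - recip q) * b t) * rearrangement R f t)"

definition LK_space ::
    "'a measure \<Rightarrow> ennreal \<Rightarrow> ennreal \<Rightarrow> (real \<Rightarrow> real) \<Rightarrow> ('a \<Rightarrow> complex option) set" where
  "LK_space R p q b = {f \<in> ext_measurable R. LK_norm R p q b f < \<infinity>}"

text \<open>The choice of the set is immaterial, as \<open>LK_norm_indicator_cong\<close> shows.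
  On a non-atomic \<open>\<sigma>\<close>-finite space of infinite measure a set of every measure in
  \<open>[0,\<infinity>]\<close> exists.\<close>

definition fundamental_function ::
    "'a measure \<Rightarrow> ennreal \<Rightarrow> ennreal \<Rightarrow> (real \<Rightarrow> real) \<Rightarrow> ennreal \<Rightarrow> ennreal" where
  "fundamental_function R p q b t =
     LK_norm R p q b (ext_indicator (SOME E. E \<in> sets R \<and> emeasure R E = t))"

lemma LK_norm_indicator_cong:
  assumes "E \<in> sets R" "F \<in> sets R" "emeasure R E = emeasure R F"
  shows "LK_norm R p q b (ext_indicator E) = LK_norm R p q b (ext_indicator F)"
proof -
  have *: "{x \<in> space R. ennreal s < ext_mod (ext_indicator A x)} = (if s < 1 then A else {})"
    if "A \<in> sets R" "0 \<le> s" for A s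
    using sets.sets_into_space[OF that(1)] that(2)
    by (auto simp: ext_indicator_def indicator_def ennreal_less_iff split: if_splits)
  have "emeasure R {x \<in> space R. ennreal s < ext_mod (ext_indicator E x)} =
        emeasure R {x \<in> space R. ennreal s < ext_mod (ext_indicator F x)}" if "0 \<le> s" for s
    using assms that by (simp add: *)
  then have "rearrangement R (ext_indicator E) = rearrangement R (ext_indicator F)"
    unfolding rearrangement_def by (intro ext arg_cong[where f = Inf]) auto
  then show ?thesis
    by (simp add: LK_norm_def)
qed

definition quasi_concave :: "(real \<Rightarrow> real) \<Rightarrow> bool" where
  "quasi_concave \<phi> \<longleftrightarrow>
     (\<forall>t\<ge>0. 0 \<le> \<phi> t) \<and> mono_on {0..} \<phi> \<and> (\<forall>t\<ge>0. \<phi> t = 0 \<longleftrightarrow> t = 0) \<and>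
     mono_on {0<..} (\<lambda>t. t / \<phi> t)"

end

theory Submission
  imports Defs
begin

text \<open>The rearrangement of an indicator is again an indicator, so with \<open>a = 1/p\<close> the fundamental
  function at \<open>t\<close> is the \<open>L\<^sup>q\<close> quasi-norm of \<open>s powr (a - 1/q) * b s\<close> over \<open>(0,t)\<close>. Since
  \<open>s powr (a/2) * b s\<close> is almost increasing, the remaining power \<open>s powr (a/2 - 1/q)\<close> gives the upper
  bound; since \<open>b s / s\<close> is almost decreasing, the interval \<open>(t/2,t)\<close> alone gives the lower one.
  Dividing by \<open>t\<close>, an equivalent quasi-concave function would make \<open>t powr (a - 1) * b t\<close> equivalent to
  a non-increasing function, which is excluded for \<open>a = 1\<close> and impossible for \<open>a > 1\<close> because this
  product is then unbounded at infinity.\<close>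

section \<open>Sets of prescribed measure\<close>

text \<open>Repeated halving: non-atomicity splits any non-null set into two non-null pieces, and
  the smaller one has at most half the measure. After \<open>n\<close> rounds at most
  \<open>measure R A / 2 ^ n\<close> is left.\<close>

lemma nonatomic_ex_small_subset:
  assumes na: "nonatomic R" and A: "A \<in> sets R" "0 < emeasure R A" "emeasure R A < \<infinity>"
    and e: "0 < (e::real)"
  shows "\<exists>B\<in>sets R. B \<subseteq> A \<and> 0 < measure R B \<and> measure R B \<le> e"
proof -
  have halve: "\<exists>C\<in>sets R. C \<subseteq> B \<and> 0 < measure R C \<and> measure R C \<le> measure R B / 2"
    if B: "B \<in> sets R" "B \<subseteq> A" "0 < measure R B" for B
  proof -
    have fin: "emeasure R D < \<infinity>" if "D \<subseteq> A" for D
      using emeasure_mono[OF that A(1)] A(3) by (simp add: order_le_less_trans)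
    have "0 < emeasure R B"
      using B by (simp add: measure_def enn2real_positive_iff)
    then obtain C where C: "C \<in> sets R" "C \<subseteq> B" "0 < emeasure R C" "emeasure R C < emeasure R B"
      using na B unfolding nonatomic_def by blast
    have CA: "C \<subseteq> A" using C B by auto
    \<comment> \<open>\<open>measure\<close> is 0 on sets of infinite measure, so finiteness is
      needed to carry the strict inequalities over to real numbers.\<close>
    have eC: "emeasure R C = ennreal (measure R C)" and eB: "emeasure R B = ennreal (measure R B)"
      using fin[OF CA] fin[OF B(2)] by (simp_all add: emeasure_eq_ennreal_measure)
    have m: "0 < measure R C" "measure R C < measure R B"
      using C(3,4) unfolding eC eB by (simp_all add: ennreal_less_iff)
    \<comment> \<open>The measures of \<open>C\<close> and \<open>B - C\<close> add up to that of
      \<open>B\<close> and both are positive, so the piece with at most half the measure serves as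
      witness.\<close>
    have "measure R (B - C) = measure R B - measure R C"
      using B C fin[OF B(2)] by (intro measure_Diff) auto
    then show ?thesis
      using m B C
      by (intro bexI[of _ "if measure R C \<le> measure R B / 2 then C else B - C"]) auto
  qed
  have "\<exists>B\<in>sets R. B \<subseteq> A \<and> 0 < measure R B \<and> measure R B \<le> measure R A / 2 ^ n" for n
  proof (induction n)
    case 0
    then show ?case using A by (auto intro!: bexI[of _ A] simp: measure_def enn2real_positive_iff)
  next
    case (Suc n)
    then obtain B where B: "B \<in> sets R" "B \<subseteq> A" "0 < measure R B" "measure R B \<le> measure R A / 2 ^ n"
      by blast
    from halve[OF B(1-3)] obtain C
      where "C \<in> sets R" "C \<subseteq> B" "0 < measure R C" "measure R C \<le> measure R B / 2" by blast
    moreover have "measure R B / 2 \<le> measure R A / 2 ^ Suc n"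
      using B(4) by simp
    ultimately show ?case using B(2) by (meson order_trans)
  qed
  moreover obtain n where "measure R A / e < 2 ^ n"
    using real_arch_pow[of 2] by auto
  then have "measure R A / 2 ^ n \<le> e"
    using e by (simp add: field_simps)
  ultimately show ?thesis
    by (meson order_trans)
qed

text \<open>Greedy exhaustion: each step gains at least half of what can still be gained below the
  bound \<open>t\<close>, so nothing can be gained in the limit.\<close>

lemma nonatomic_ex_subset_measure_eq:
  assumes na: "nonatomic R" and A: "A \<in> sets R" "emeasure R A < \<infinity>"
    and t: "0 \<le> t" "t \<le> measure R A"
  shows "\<exists>B\<in>sets R. B \<subseteq> A \<and> measure R B = t"
proof -
  define P where "P = {B \<in> sets R. B \<subseteq> A \<and> measure R B \<le> t}"
  have fin: "emeasure R D < \<infinity>" if "D \<subseteq> A" for D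
    using emeasure_mono[OF that A(1)] A(2) by (simp add: order_le_less_trans)
  have step: "\<exists>C\<in>P. B \<subseteq> C \<and>
      (\<forall>D\<in>P. B \<subseteq> D \<longrightarrow> measure R B + measure R D \<le> 2 * measure R C)" if B: "B \<in> P" for B
  proof -
    define S where "S = measure R ` {D \<in> P. B \<subseteq> D}"
    have bdd: "bdd_above S" by (auto simp: S_def P_def intro: bdd_aboveI[of _ t])
    have inS: "measure R B \<in> S" using B by (auto simp: S_def)
    have le: "measure R D \<le> Sup S" if "D \<in> P" "B \<subseteq> D" for D
      using that bdd by (intro cSup_upper) (auto simp: S_def)
    show ?thesis
    \<comment> \<open>If nothing can be gained, \<open>B\<close> itself works. Otherwise some
      competitor exceeds the midpoint of \<open>measure R B\<close> and \<open>Sup S\<close>, which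
      secures at least half of the possible gain.\<close>
    proof (cases "Sup S \<le> measure R B")
      case True
      then show ?thesis using B le by (intro bexI[of _ B]) fastforce+
    next
      case False
      then have "(measure R B + Sup S) / 2 < Sup S" by simp
      then obtain y where y: "y \<in> S" "(measure R B + Sup S) / 2 < y"
        using less_cSupE[of _ S] inS by blast
      then obtain C where "C \<in> P" "B \<subseteq> C" "(measure R B + Sup S) / 2 < measure R C"
        by (auto simp: S_def)
      then show ?thesis using le by (intro bexI[of _ C]) fastforce+
    qed
  qed
  have "\<exists>f. \<forall>n. f n \<in> P \<and> (f n \<subseteq> f (Suc n) \<and>
      (\<forall>D\<in>P. f n \<subseteq> D \<longrightarrow> measure R (f n) + measure R D \<le> 2 * measure R (f (Suc n))))"
  proof (rule dependent_nat_choice)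
    show "\<exists>x. x \<in> P" using t by (intro exI[of _ "{}"]) (auto simp: P_def)
  qed (use step in blast)
  then obtain B where BP: "\<And>n. B n \<in> P" and Bs: "\<And>n. B n \<subseteq> B (Suc n)"
    and gain: "\<And>n D. D \<in> P \<Longrightarrow> B n \<subseteq> D \<Longrightarrow> measure R (B n) + measure R D \<le> 2 * measure R (B (Suc n))"
    by blast
  define U where "U = (\<Union>n. B n)"
  have US: "U \<in> sets R" "U \<subseteq> A" using BP by (auto simp: U_def P_def)
  have lim: "(\<lambda>n. measure R (B n)) \<longlonglongrightarrow> measure R U"
    unfolding U_def using BP Bs US(2) fin[of U]
    by (intro Lim_measure_incseq incseq_SucI) (auto simp: P_def U_def)
  have Ut: "measure R U \<le> t"
    using BP by (intro LIMSEQ_le_const2[OF lim]) (auto simp: P_def)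
  \<comment> \<open>A superset of \<open>U\<close> contains every \<open>B n\<close>, so it may be
    put into \<open>gain\<close>; both \<open>measure R (B n)\<close> and
    \<open>measure R (B (Suc n))\<close> tend to \<open>measure R U\<close>.\<close>
  have max: "measure R D \<le> measure R U" if "D \<in> P" "U \<subseteq> D" for D
  proof -
    have "measure R U + measure R D \<le> 2 * measure R U"
    proof (rule LIMSEQ_le)
      show "(\<lambda>n. measure R (B n) + measure R D) \<longlonglongrightarrow> measure R U + measure R D"
        by (intro tendsto_intros lim)
      show "(\<lambda>n. 2 * measure R (B (Suc n))) \<longlonglongrightarrow> 2 * measure R U"
        by (intro tendsto_intros LIMSEQ_Suc lim)
      show "\<exists>N. \<forall>n\<ge>N. measure R (B n) + measure R D \<le> 2 * measure R (B (Suc n))"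
        using gain[OF that(1)] that(2) by (intro exI[of _ 0]) (auto simp: U_def)
    qed
    then show ?thesis by simp
  qed
  have "measure R U = t"
  proof (rule ccontr)
    assume "measure R U \<noteq> t"
    with Ut have lt: "measure R U < t" by simp
    \<comment> \<open>If \<open>U\<close> fell short of \<open>t\<close>, then \<open>A - U\<close>
      would contain a non-null set no larger than the deficit, and adding it to \<open>U\<close>
      would contradict \<open>max\<close>.\<close>
    have "measure R (A - U) = measure R A - measure R U"
      using A US by (intro measure_Diff) auto
    then have "0 < measure R (A - U)" using lt t by simp
    then have "0 < emeasure R (A - U)" by (simp add: measure_def enn2real_positive_iff)
    then obtain D where D: "D \<in> sets R" "D \<subseteq> A - U" "0 < measure R D" "measure R D \<le> t - measure R U"
      using nonatomic_ex_small_subset[OF na, of "A - U" "t - measure R U"] A US lt fin[of "A - U"]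
      by auto
    have "D \<subseteq> A" using D(2) by blast
    then have "emeasure R U \<noteq> \<infinity>" "emeasure R D \<noteq> \<infinity>"
      using fin[OF US(2)] fin[of D] by simp_all
    then have mUD: "measure R (U \<union> D) = measure R U + measure R D"
      using D US by (intro measure_Union) auto
    have "U \<union> D \<in> P"
      using D US mUD by (auto simp: P_def)
    then show False using max[of "U \<union> D"] D(3) mUD by auto
  qed
  with US show ?thesis by blast
qed

text \<open>The value infinity is attained by the whole space. For a finite value, sigma-finiteness
  supplies a set of finite but larger measure, inside which the previous lemma cuts out the right
  amount.\<close>

lemma nonatomic_sigma_finite_ex_emeasure_eq:
  assumes "sigma_finite_measure R" "nonatomic R" "emeasure R (space R) = \<infinity>"
  shows "\<exists>E. E \<in> sets R \<and> emeasure R E = T"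
proof (cases T)
  case (real t)
  obtain Z where Z: "Z \<in> sets R" "emeasure R Z < \<infinity>" "ennreal t < emeasure R Z"
    using sigma_finite_measure.approx_PInf_emeasure_with_finite[OF assms(1) sets.top assms(3)] by metis
  then have "t \<le> measure R Z"
    using real(1) by (simp add: emeasure_eq_ennreal_measure ennreal_less_iff)
  then obtain B where "B \<in> sets R" "B \<subseteq> Z" "measure R B = t"
    using nonatomic_ex_subset_measure_eq[OF assms(2) Z(1,2) real(1)] by blast
  moreover have "emeasure R B < \<infinity>"
    using emeasure_mono[OF \<open>B \<subseteq> Z\<close> Z(1)] Z(2) by (simp add: order_le_less_trans)
  ultimately show ?thesis
    using real by (auto simp: emeasure_eq_ennreal_measure)
qed (use assms(3) in \<open>auto intro!: exI[of _ "space R"]\<close>)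

section \<open>Equivalence of functions and slow variation\<close>

lemma equiv_on_sym:
  assumes "equiv_on S g h"
  shows "equiv_on S h g"
proof -
  obtain c C :: real where c: "0 < c" "c \<le> C"
    and eq: "\<And>t. t \<in> S \<Longrightarrow> ennreal c * g t \<le> h t \<and> h t \<le> ennreal C * g t"
    using assms unfolding equiv_on_def by blast
  show ?thesis
    unfolding equiv_on_def
  proof (rule exI[of _ "1/C"], rule exI[of _ "1/c"], intro conjI ballI)
    fix t assume t: "t \<in> S"
    have "ennreal (1/C) * h t \<le> ennreal (1/C) * (ennreal C * g t)"
      using eq[OF t] by (intro mult_left_mono) auto
    also have "\<dots> = g t"
      using c by (simp add: mult.assoc[symmetric] ennreal_mult[symmetric])
    finally show "ennreal (1/C) * h t \<le> g t" .
    have "g t = ennreal (1/c) * (ennreal c * g t)"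
      using c by (simp add: mult.assoc[symmetric] ennreal_mult[symmetric])
    also have "\<dots> \<le> ennreal (1/c) * h t"
      using eq[OF t] by (intro mult_left_mono) auto
    finally show "g t \<le> ennreal (1/c) * h t" .
  qed (use c in \<open>auto simp: field_simps\<close>)
qed

lemma equiv_on_trans:
  assumes "equiv_on S f g" "equiv_on S g h"
  shows "equiv_on S f h"
proof -
  obtain c C :: real where c: "0 < c" "c \<le> C"
    and 1: "\<And>t. t \<in> S \<Longrightarrow> ennreal c * f t \<le> g t \<and> g t \<le> ennreal C * f t"
    using assms(1) unfolding equiv_on_def by blast
  obtain d D :: real where d: "0 < d" "d \<le> D"
    and 2: "\<And>t. t \<in> S \<Longrightarrow> ennreal d * g t \<le> h t \<and> h t \<le> ennreal D * g t"
    using assms(2) unfolding equiv_on_def by blast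
  show ?thesis
    unfolding equiv_on_def
  proof (rule exI[of _ "d*c"], rule exI[of _ "D*C"], intro conjI ballI)
    fix t assume t: "t \<in> S"
    have "ennreal (d*c) * f t = ennreal d * (ennreal c * f t)"
      using c d by (simp add: ennreal_mult mult.assoc)
    also have "\<dots> \<le> ennreal d * g t"
      using 1[OF t] by (intro mult_left_mono) auto
    finally show "ennreal (d*c) * f t \<le> h t" using 2[OF t] by (blast intro: order_trans)
    have "h t \<le> ennreal D * g t" using 2[OF t] by simp
    also have "\<dots> \<le> ennreal D * (ennreal C * f t)"
      using 1[OF t] by (intro mult_left_mono) auto
    also have "\<dots> = ennreal (D*C) * f t"
      using c d by (simp add: ennreal_mult mult.assoc)
    finally show "h t \<le> ennreal (D*C) * f t" .
  qed (use c d in \<open>auto intro!: mult_mono\<close>)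
qed

lemma equiv_on_ennreal_iff:
  assumes "\<And>t. t \<in> S \<Longrightarrow> 0 \<le> F t" "\<And>t. t \<in> S \<Longrightarrow> 0 \<le> G t"
  shows "equiv_on S (\<lambda>t. ennreal (F t)) (\<lambda>t. ennreal (G t)) \<longleftrightarrow>
    (\<exists>c C. 0 < c \<and> c \<le> C \<and> (\<forall>t\<in>S. c * F t \<le> G t \<and> G t \<le> C * F t))"
  unfolding equiv_on_def
  by (intro ex_cong1 conj_cong refl ball_cong)
     (use assms in \<open>auto simp: ennreal_mult[symmetric] ennreal_le_iff\<close>)

text \<open>The chain \<open>c * F s\<close> \<le> \<open>g s\<close> \<le> \<open>g t\<close> \<le>
  \<open>C * F t\<close> gives the factor \<open>C/c\<close>. Assuming only \<open>g s\<close> \<le>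
  \<open>g t\<close> lets the lemma serve non-decreasing and non-increasing \<open>g\<close>
  alike.\<close>

lemma equiv_on_le_imp_le_mult:
  fixes F :: "'a \<Rightarrow> real"
  assumes "equiv_on S (\<lambda>t. ennreal (F t)) g" "\<And>t. t \<in> S \<Longrightarrow> 0 \<le> F t"
  obtains K where "0 < K" "\<And>s t. s \<in> S \<Longrightarrow> t \<in> S \<Longrightarrow> g s \<le> g t \<Longrightarrow> F s \<le> K * F t"
proof -
  obtain c C :: real where c: "0 < c" "c \<le> C"
    and eq: "\<And>t. t \<in> S \<Longrightarrow> ennreal c * F t \<le> g t \<and> g t \<le> ennreal C * F t"
    using assms(1) unfolding equiv_on_def by blast
  show ?thesis
  proof (rule that[of "C/c"])
    fix s t assume st: "s \<in> S" "t \<in> S" "g s \<le> g t"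
    have "ennreal c * F s \<le> ennreal C * F t"
      using eq[OF st(1)] eq[OF st(2)] st(3) by (blast intro: order_trans)
    then have "c * F s \<le> C * F t"
      using c assms(2)[OF st(1)] assms(2)[OF st(2)]
      by (simp add: ennreal_mult[symmetric] ennreal_le_iff)
    then show "F s \<le> C/c * F t"
      using c by (simp add: field_simps)
  qed (use c in auto)
qed

section \<open>Almost monotonicity and growth of slowly varying functions\<close>

lemma slowly_varying_pos: "slowly_varying b \<Longrightarrow> 0 < t \<Longrightarrow> 0 < b t"
  by (simp add: slowly_varying_def)

lemma slowly_varying_almost_incr:
  assumes "slowly_varying b" "0 < e"
  obtains K where "0 < K"
    "\<And>s t. 0 < s \<Longrightarrow> s \<le> t \<Longrightarrow> s powr e * b s \<le> K * (t powr e * b t)"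
proof -
  obtain g :: "real \<Rightarrow> ennreal" where g: "mono_on {0<..} g"
    "equiv_on {0<..} (\<lambda>t. ennreal (t powr e * b t)) g"
    using assms unfolding slowly_varying_def by blast
  show ?thesis
  proof (rule equiv_on_le_imp_le_mult[OF g(2)])
    fix K :: real
    assume K: "0 < K" and "\<And>s t. s \<in> {0<..} \<Longrightarrow> t \<in> {0<..} \<Longrightarrow> g s \<le> g t \<Longrightarrow>
      s powr e * b s \<le> K * (t powr e * b t)"
    then show thesis
      using that[OF K] g(1) by (auto simp: monotone_on_def)
  qed (use slowly_varying_pos[OF assms(1)] in \<open>auto intro: less_imp_le\<close>)
qed

lemma slowly_varying_almost_decr:
  assumes "slowly_varying b" "0 < e"
  obtains K where "0 < K"
    "\<And>s t. 0 < s \<Longrightarrow> s \<le> t \<Longrightarrow> t powr (-e) * b t \<le> K * (s powr (-e) * b s)"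
proof -
  obtain g :: "real \<Rightarrow> ennreal" where g: "antimono_on {0<..} g"
    "equiv_on {0<..} (\<lambda>t. ennreal (t powr (-e) * b t)) g"
    using assms unfolding slowly_varying_def by blast
  show ?thesis
  proof (rule equiv_on_le_imp_le_mult[OF g(2)])
    fix K :: real
    assume K: "0 < K" and "\<And>s t. s \<in> {0<..} \<Longrightarrow> t \<in> {0<..} \<Longrightarrow> g s \<le> g t \<Longrightarrow>
      s powr (-e) * b s \<le> K * (t powr (-e) * b t)"
    then show thesis
      using that[OF K] g(1) by (auto simp: monotone_on_def)
  qed (use slowly_varying_pos[OF assms(1)] in \<open>auto intro: less_imp_le\<close>)
qed

text \<open>The exponent is split in two: almost monotonicity keeps
  \<open>t powr (d/2) * b t\<close> above \<open>b 1 / K\<close> for \<open>t\<close> \<ge> 1, while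
  the other factor \<open>t powr (d/2)\<close> grows without bound.\<close>

lemma slowly_varying_powr_unbounded:
  assumes b: "slowly_varying b" and d: "0 < d"
  obtains t where "1 \<le> t" "M < t powr d * b t"
proof -
  obtain K where K: "0 < K"
    "\<And>s t. 0 < s \<Longrightarrow> s \<le> t \<Longrightarrow> s powr (d/2) * b s \<le> K * (t powr (d/2) * b t)"
    using slowly_varying_almost_incr[OF b, of "d/2"] d by (metis half_gt_zero)
  have b1: "0 < b 1" using slowly_varying_pos[OF b] by simp
  \<comment> \<open>Chosen so that \<open>x * (b 1 / K)\<close> equals
    \<open>b 1 / K + \<bar>M\<bar>\<close>, which exceeds \<open>M\<close>; then \<open>t\<close> is
    chosen to make \<open>t powr (d/2)\<close> equal to \<open>x\<close>.\<close>
  define x where "x = 1 + \<bar>M\<bar> * K / b 1"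
  have x1: "1 \<le> x" using K b1 by (simp add: x_def)
  define t where "t = x powr (2/d)"
  have t1: "1 \<le> t" using x1 d by (simp add: t_def ge_one_powr_ge_zero)
  have tx: "t powr (d/2) = x" using x1 d by (simp add: t_def powr_powr)
  have "M < b 1 / K + \<bar>M\<bar>"
    using divide_pos_pos[OF b1 K(1)] by linarith
  also have "\<dots> = x * (b 1 / K)"
    using K b1 by (simp add: x_def field_simps)
  also have "\<dots> \<le> x * (t powr (d/2) * b t)"
    using K(2)[of 1 t] t1 x1 K(1) by (intro mult_left_mono) (auto simp: field_simps)
  also have "\<dots> = t powr d * b t"
    by (simp add: tx[symmetric] mult.assoc[symmetric] powr_add[symmetric])
  finally show ?thesis using t1 that by blast
qed

section \<open>Bounds for the quasi-norm\<close>

lemma ennreal_powr_mono: "x \<le> y \<Longrightarrow> 0 \<le> r \<Longrightarrow> ennreal_powr x r \<le> ennreal_powr y r"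
  by (cases x; cases y) (auto simp: ennreal_powr_def top_unique ennreal_leI powr_mono2)

lemma ennreal_powr_ennreal: "0 \<le> x \<Longrightarrow> ennreal_powr (ennreal x) r = ennreal (x powr r)"
  by (simp add: ennreal_powr_def)

lemma enn2real_pos: "0 < q \<Longrightarrow> q \<noteq> \<infinity> \<Longrightarrow> 0 < enn2real q"
  by (simp add: enn2real_positive_iff less_top)

lemma nn_integral_lebesgue_on_pos:
  "(\<integral>\<^sup>+s. f s \<partial>lebesgue_on {0<..}) = (\<integral>\<^sup>+s. f s * indicator {0<..} (s::real) \<partial>lborel)"
  by (subst nn_integral_restrict_space) (auto simp: nn_integral_completion)

text \<open>The bound is the quasi-norm of \<open>c\<close> times the indicator of the interval; for
  infinite \<open>q\<close> the length enters with exponent 0.\<close>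

lemma Lq_norm_lower_bound:
  fixes u v :: real
  assumes q: "0 < q" and uv: "0 < u" "u < v" and c: "0 \<le> c"
    and le: "\<And>s. u < s \<Longrightarrow> s < v \<Longrightarrow> ennreal c \<le> g s"
  shows "ennreal (c * (v - u) powr recip q) \<le> Lq_norm q g"
proof (cases "q = \<infinity>")
  case True
  have "ennreal c \<le> esssup (lebesgue_on {0<..}) g"
  \<comment> \<open>An essential supremum below \<open>c\<close> would force almost every point to
    avoid the interval, which has positive length.\<close>
  proof (rule ccontr)
    assume "\<not> ?thesis"
    moreover have "AE s in lebesgue_on {0<..}. g s \<le> esssup (lebesgue_on {0<..}) g"
      by (rule esssup_AE)
    ultimately have "AE s in lebesgue_on {0<..}. s \<notin> {u<..<v}"
    proof (elim eventually_mono)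
      fix s
      assume "\<not> ennreal c \<le> esssup (lebesgue_on {0<..}) g" "g s \<le> esssup (lebesgue_on {0<..}) g"
      then show "s \<notin> {u<..<v}"
        using le[of s] order_trans by auto
    qed
    then have "AE s in lebesgue. s \<notin> {u<..<v}"
      using uv by (subst (asm) AE_restrict_space_iff) (auto elim!: eventually_mono)
    then have "{u<..<v} \<in> null_sets lebesgue"
      by (subst AE_iff_null_sets) auto
    then show False
      using uv by (simp add: null_sets_def)
  qed
  then show ?thesis
    using True uv by (simp add: Lq_norm_def recip_def)
next
  case False
  define Q where "Q = enn2real q"
  have Q: "0 < Q" using enn2real_pos[OF q False] by (simp add: Q_def)
  have "ennreal (c powr Q * (v - u)) = (\<integral>\<^sup>+s. ennreal (c powr Q) * indicator {u<..<v} s \<partial>lborel)"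
    using uv by (subst nn_integral_cmult_indicator) (auto simp: ennreal_mult)
  also have "\<dots> \<le> (\<integral>\<^sup>+s. ennreal_powr (g s) Q \<partial>lebesgue_on {0<..})"
    unfolding nn_integral_lebesgue_on_pos
  proof (intro nn_integral_mono)
    fix s
    show "ennreal (c powr Q) * indicator {u<..<v} s \<le> ennreal_powr (g s) Q * indicator {0<..} s"
      using uv ennreal_powr_mono[OF le[of s], of Q] Q c
      by (auto simp: indicator_def ennreal_powr_ennreal)
  qed
  finally have "ennreal_powr (ennreal (c powr Q * (v - u))) (1/Q) \<le> Lq_norm q g"
    using False Q by (auto simp: Lq_norm_def Q_def intro!: ennreal_powr_mono)
  moreover have "(c powr Q * (v - u)) powr (1/Q) = c * (v - u) powr (1/Q)"
    using Q c uv by (simp add: powr_mult powr_powr)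
  ultimately show ?thesis
    using False Q c uv by (simp add: ennreal_powr_ennreal recip_def Q_def)
qed

text \<open>For finite \<open>q\<close> the \<open>q\<close>-th power of the majorant is a multiple
  of \<open>s powr (a * enn2real q - 1)\<close>, integrable at 0 because \<open>a\<close> is
  positive; for infinite \<open>q\<close> it is increasing in \<open>s\<close>. The factor
  \<open>c\<close> may depend on \<open>t\<close>, whereas the final factor depends only on
  \<open>a\<close> and \<open>q\<close>.\<close>

lemma Lq_norm_upper_bound:
  fixes t :: real
  assumes q: "0 < q" and t: "0 < t" and c: "0 \<le> c" and a: "0 < a"
    and meas: "g \<in> borel_measurable (lebesgue_on {0<..})"
    and le: "\<And>s. 0 < s \<Longrightarrow> s < t \<Longrightarrow> g s \<le> ennreal (c * s powr (a - recip q))"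
    and zero: "\<And>s. t \<le> s \<Longrightarrow> g s = 0"
  shows "Lq_norm q g \<le>
    ennreal (c * t powr a * (if q = \<infinity> then 1 else (1 / (a * enn2real q)) powr (1 / enn2real q)))"
proof (cases "q = \<infinity>")
  case True
  have "g s \<le> ennreal (c * t powr a)" if "0 < s" for s
  proof (cases "s < t")
    case True
    have "g s \<le> ennreal (c * s powr a)"
      using le[OF that True] \<open>q = \<infinity>\<close> by (simp add: recip_def)
    also have "\<dots> \<le> ennreal (c * t powr a)"
      using True that a c by (intro ennreal_leI mult_left_mono powr_mono2) auto
    finally show ?thesis .
  qed (simp add: zero)
  then have "esssup (lebesgue_on {0<..}) g \<le> ennreal (c * t powr a)"
    by (intro esssup_I meas AE_I2) simp
  then show ?thesis
    using True by (simp add: Lq_norm_def)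
next
  case False
  define Q where "Q = enn2real q"
  have Q: "0 < Q" using enn2real_pos[OF q False] by (simp add: Q_def)
  have rq: "recip q = 1/Q" using False by (simp add: recip_def Q_def)
  have "(\<integral>\<^sup>+s. ennreal_powr (g s) Q \<partial>lebesgue_on {0<..}) \<le>
      (\<integral>\<^sup>+s. ennreal (c powr Q) * (ennreal (s powr (a * Q - 1)) * indicator {0..t} s) \<partial>lborel)"
    unfolding nn_integral_lebesgue_on_pos
  proof (intro nn_integral_mono)
    fix s
    have "ennreal_powr (g s) Q \<le> ennreal (c powr Q) * ennreal (s powr (a * Q - 1))"
      if s: "0 < s" "s < t"
    proof -
      have "ennreal_powr (g s) Q \<le> ennreal ((c * s powr (a - recip q)) powr Q)"
        using ennreal_powr_mono[OF le[OF s], of Q] Q c by (simp add: ennreal_powr_ennreal)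
      also have "(c * s powr (a - recip q)) powr Q = c powr Q * s powr (a * Q - 1)"
        using Q c s by (simp add: powr_mult powr_powr rq left_diff_distrib)
      finally show ?thesis by (simp add: ennreal_mult)
    qed
    then show "ennreal_powr (g s) Q * indicator {0<..} s \<le>
        ennreal (c powr Q) * (ennreal (s powr (a * Q - 1)) * indicator {0..t} s)"
      using zero[of s] by (cases "s < t") (auto simp: indicator_def ennreal_powr_def)
  qed
  also have "\<dots> = ennreal (c powr Q) * ennreal (t powr (a * Q) / (a * Q))"
    using has_integral_powr_from_0[of "a * Q - 1" t] a Q t
    by (subst nn_integral_cmult) (auto simp: nn_integral_has_integral_lebesgue')
  also have "\<dots> = ennreal (c powr Q * t powr (a * Q) / (a * Q))"
    using a Q by (simp add: ennreal_mult[symmetric])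
  finally have "Lq_norm q g \<le> ennreal_powr (ennreal (c powr Q * t powr (a * Q) / (a * Q))) (1/Q)"
    using False Q by (auto simp: Lq_norm_def Q_def intro!: ennreal_powr_mono)
  moreover have "(c powr Q * t powr (a * Q) / (a * Q)) powr (1/Q) =
      c * t powr a * (1 / (a * Q)) powr (1/Q)"
    using Q c a t by (simp add: powr_mult powr_powr powr_divide)
  ultimately show ?thesis
    using False Q c a by (simp add: ennreal_powr_ennreal Q_def)
qed

section \<open>The fundamental function\<close>

text \<open>The level set at height \<open>r\<close> is \<open>E\<close> for \<open>r < 1\<close>
  and empty from 1 on. So height 1 is always admissible, and a height below 1 is admissible only if
  \<open>emeasure R E\<close> \<le> \<open>ennreal s\<close>, in which case 0 is too.\<close>

lemma rearrangement_indicator: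
  assumes "E \<in> sets R"
  shows "rearrangement R (ext_indicator E) s = (if ennreal s < emeasure R E then 1 else 0)"
proof -
  have lev: "{x \<in> space R. ennreal r < ext_mod (ext_indicator E x)} = (if r < 1 then E else {})"
    if "0 \<le> r" for r
    using sets.sets_into_space[OF assms] that
    by (auto simp: ext_indicator_def indicator_def ennreal_less_iff split: if_splits)
  show ?thesis
  proof (cases "ennreal s < emeasure R E")
    case True
    have "rearrangement R (ext_indicator E) s = 1"
      unfolding rearrangement_def
    proof (rule antisym)
      show "Inf {ennreal r |r. 0 \<le> r \<and>
          emeasure R {x \<in> space R. ennreal r < ext_mod (ext_indicator E x)} \<le> ennreal s} \<le> 1"
        by (intro Inf_lower CollectI exI[of _ "1::real"] conjI) (subst lev | simp)+
      show "1 \<le> Inf {ennreal r |r. 0 \<le> r \<and>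
          emeasure R {x \<in> space R. ennreal r < ext_mod (ext_indicator E x)} \<le> ennreal s}"
        using True by (intro Inf_greatest) (auto simp: lev not_less split: if_splits)
    qed
    with True show ?thesis by simp
  next
    case False
    then have "rearrangement R (ext_indicator E) s \<le> ennreal 0"
      unfolding rearrangement_def by (intro Inf_lower CollectI exI[of _ "0::real"]) (subst lev | simp add: not_less)+
    with False show ?thesis by simp
  qed
qed

text \<open>Since a set of each measure exists, the choice operator picks a genuine one, and its
  rearrangement depends on \<open>T\<close> alone. The measure space thereby drops out of all later
  estimates.\<close>

lemma fundamental_function_eq_Lq_norm:
  assumes "sigma_finite_measure R" "nonatomic R" "emeasure R (space R) = \<infinity>"
  shows "fundamental_function R p q b T =
    Lq_norm q (\<lambda>s. ennreal (s powr (recip p - recip q) * b s) * (if ennreal s < T then 1 else 0))"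
proof -
  define E where "E = (SOME E. E \<in> sets R \<and> emeasure R E = T)"
  have "E \<in> sets R \<and> emeasure R E = T"
    unfolding E_def by (rule someI_ex) (rule nonatomic_sigma_finite_ex_emeasure_eq[OF assms])
  then show ?thesis
    by (simp add: fundamental_function_def LK_norm_def rearrangement_indicator flip: E_def)
qed

text \<open>Only the part of the norm over \<open>(t/2, t)\<close> is used, so the bound holds for
  every \<open>T\<close> \<ge> \<open>t\<close>; this form also covers \<open>T\<close> = infinity,
  with \<open>t\<close> arbitrary.\<close>

lemma fundamental_function_lower_bound:
  assumes R: "sigma_finite_measure R" "nonatomic R" "emeasure R (space R) = \<infinity>"
    and q: "0 < q" and b: "slowly_varying b" and a: "0 \<le> recip p"
  obtains c where "0 < c" "\<And>t T. 0 < t \<Longrightarrow> ennreal t \<le> T \<Longrightarrow>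
    ennreal (c * (t powr recip p * b t)) \<le> fundamental_function R p q b T"
proof -
  define a r where "a = recip p" and "r = recip q"
  have r0: "0 \<le> r" by (simp add: r_def recip_def)
  obtain K where K: "0 < K"
    "\<And>s t. 0 < s \<Longrightarrow> s \<le> t \<Longrightarrow> t powr (-1) * b t \<le> K * (s powr (-1) * b s)"
    using slowly_varying_almost_decr[OF b, of 1] by (metis zero_less_one)
  \<comment> \<open>\<open>1 / K\<close> is the loss from the almost decreasing
    \<open>b s / s\<close>, and \<open>(1/2) powr (a + 1)\<close> is the loss from replacing
    \<open>s\<close> by \<open>t/2\<close>.\<close>
  define k where "k = 1 / K * (1/2) powr (a + 1)"
  show ?thesis
  proof (rule that[of "k * (1/2) powr r"])
    show "0 < k * (1/2) powr r" using K by (simp add: k_def)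
    fix t :: real and T assume t: "0 < t" "ennreal t \<le> T"
    have bt: "0 < b t" using slowly_varying_pos[OF b t(1)] .
    let ?g = "\<lambda>s. ennreal (s powr (recip p - recip q) * b s) * (if ennreal s < T then 1 else 0)"
    \<comment> \<open>The exponent \<open>a - r\<close> is split into an increasing power, a
      decreasing power and the power -1 that goes with \<open>b\<close>, so each factor can be
      estimated separately on \<open>(t/2, t)\<close>.\<close>
    have pw: "x powr (a + 1) * x powr (-r) * x powr (-1) = x powr (a - r)" if "0 < x" for x :: real
      using that by (simp add: powr_add powr_diff powr_minus field_simps)
    have le: "ennreal (k * (t powr (a - r) * b t)) \<le> ?g s" if s: "t/2 < s" "s < t" for s
    proof -
      have s0: "0 < s" using s t by simp
      have "(t/2) powr (a + 1) * t powr (-r) * (1/K * (t powr (-1) * b t)) \<le>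
          s powr (a + 1) * s powr (-r) * (s powr (-1) * b s)"
      proof (rule mult_mono, rule mult_mono)
        show "(t/2) powr (a + 1) \<le> s powr (a + 1)"
          using s t a by (intro powr_mono2) (auto simp: a_def)
        show "t powr (-r) \<le> s powr (-r)"
          using s s0 r0 by (intro powr_mono2') auto
        show "1/K * (t powr (-1) * b t) \<le> s powr (-1) * b s"
          using K(2)[OF s0, of t] K(1) s by (simp add: pos_divide_le_eq mult_ac)
      qed (use K(1) bt in auto)
      also have "\<dots> = s powr (a - r) * b s"
        using pw[OF s0] by (simp only: mult.assoc[symmetric])
      also have "(t/2) powr (a + 1) * t powr (-r) * (1/K * (t powr (-1) * b t)) =
          k * ((t powr (a + 1) * t powr (-r) * t powr (-1)) * b t)"
        using t by (simp add: k_def powr_divide)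
      also have "t powr (a + 1) * t powr (-r) * t powr (-1) = t powr (a - r)"
        by (rule pw[OF t(1)])
      finally have "ennreal (k * (t powr (a - r) * b t)) \<le> ennreal (s powr (a - r) * b s)"
        by (rule ennreal_leI)
      moreover have "ennreal s < ennreal t" using s s0 by (simp add: ennreal_less_iff)
      then have "ennreal s < T" using t(2) by order
      ultimately show ?thesis by (simp add: a_def r_def)
    qed
    have "ennreal (k * (t powr (a - r) * b t) * (t - t/2) powr recip q) \<le> Lq_norm q ?g"
      using t K bt by (intro Lq_norm_lower_bound[OF q _ _ _ le]) (auto simp: k_def)
    \<comment> \<open>The interval has length \<open>t/2\<close>, whose power contributes the
      \<open>t powr r\<close> that cancels the exponent \<open>-r\<close> and the remaining constant
      \<open>(1/2) powr r\<close>.\<close>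
    also have "k * (t powr (a - r) * b t) * (t - t/2) powr recip q =
        k * (1/2) powr r * ((t powr (a - r) * t powr r) * b t)"
      using t by (simp add: r_def powr_divide)
    also have "t powr (a - r) * t powr r = t powr a"
      using t by (simp add: powr_add[symmetric])
    finally show "ennreal (k * (1/2) powr r * (t powr recip p * b t)) \<le> fundamental_function R p q b T"
      by (simp add: fundamental_function_eq_Lq_norm[OF R] a_def)
  qed
qed

text \<open>Half of the exponent \<open>recip p\<close> makes \<open>b\<close> almost increasing, so
  that this part can be frozen at \<open>t\<close>; the other half keeps the remaining power of
  \<open>s\<close> under control near 0.\<close>

lemma fundamental_function_upper_bound:
  assumes R: "sigma_finite_measure R" "nonatomic R" "emeasure R (space R) = \<infinity>"
    and q: "0 < q" and b: "slowly_varying b" and a: "0 < recip p"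
  obtains C where "0 < C" "\<And>t. 0 < t \<Longrightarrow>
    fundamental_function R p q b (ennreal t) \<le> ennreal (C * (t powr recip p * b t))"
proof -
  define a where "a = recip p"
  have a0: "0 < a/2" using a by (simp add: a_def)
  obtain K where K: "0 < K"
    "\<And>s t. 0 < s \<Longrightarrow> s \<le> t \<Longrightarrow> s powr (a/2) * b s \<le> K * (t powr (a/2) * b t)"
    using slowly_varying_almost_incr[OF b a0] by metis
  define k where "k = (if q = \<infinity> then 1 else (1 / (a/2 * enn2real q)) powr (1 / enn2real q))"
  have "k > 0" using enn2real_pos[OF q] a0 by (auto simp: k_def)
  show ?thesis
  proof (rule that[of "K * k"])
    show "0 < K * k" using K \<open>k > 0\<close> by simp
    fix t :: real assume t: "0 < t"
    have bt: "0 < b t" using slowly_varying_pos[OF b t] .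
    let ?g = "\<lambda>s. ennreal (s powr (recip p - recip q) * b s) * (if ennreal s < ennreal t then 1 else 0)"
    have [measurable]: "b \<in> borel_measurable (lebesgue_on {0<..})"
      using b by (simp add: slowly_varying_def)
    have [measurable]: "(\<lambda>s. s) \<in> borel_measurable (lebesgue_on {0<..})"
      by (intro measurable_restrict_space1 measurable_completion) simp
    have "Lq_norm q ?g \<le> ennreal (K * (t powr (a/2) * b t) * t powr (a/2) * k)"
      unfolding k_def
    proof (rule Lq_norm_upper_bound[OF q t _ a0])
      show "?g \<in> borel_measurable (lebesgue_on {0<..})" by measurable
      fix s assume s: "0 < s" "s < t"
      have "s powr (a - recip q) * b s = s powr (a/2 - recip q) * (s powr (a/2) * b s)"
        using s by (simp add: mult.assoc[symmetric] powr_add[symmetric])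
      also have "\<dots> \<le> s powr (a/2 - recip q) * (K * (t powr (a/2) * b t))"
        using K(2)[of s t] s by (intro mult_left_mono) auto
      finally have "ennreal (s powr (a - recip q) * b s) \<le>
          ennreal (K * (t powr (a/2) * b t) * s powr (a/2 - recip q))"
        by (intro ennreal_leI) (simp add: mult_ac)
      then show "?g s \<le> ennreal (K * (t powr (a/2) * b t) * s powr (a/2 - recip q))"
        by (auto simp: a_def)
    next
      fix s assume "t \<le> s"
      then show "?g s = 0" using t by (simp add: ennreal_less_iff)
    qed (use K bt in simp)
    also have "K * (t powr (a/2) * b t) * t powr (a/2) * k =
        K * k * ((t powr (a/2) * t powr (a/2)) * b t)" by simp
    also have "t powr (a/2) * t powr (a/2) = t powr a"
      by (simp add: powr_add[symmetric])
    finally show "fundamental_function R p q b (ennreal t) \<le> ennreal (K * k * (t powr recip p * b t))"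
      by (simp add: fundamental_function_eq_Lq_norm[OF R] a_def)
  qed
qed

lemma fundamental_function_equiv:
  assumes R: "sigma_finite_measure R" "nonatomic R" "emeasure R (space R) = \<infinity>"
    and q: "0 < q" and b: "slowly_varying b" and a: "0 < recip p"
  shows "equiv_on {0<..} (\<lambda>t. fundamental_function R p q b (ennreal t))
           (\<lambda>t. ennreal (t powr recip p * b t))"
proof (rule equiv_on_sym)
  obtain c where c: "0 < c" "\<And>t. 0 < t \<Longrightarrow>
    ennreal (c * (t powr recip p * b t)) \<le> fundamental_function R p q b (ennreal t)"
    using fundamental_function_lower_bound[OF R q b less_imp_le[OF a]] by (metis order_refl)
  obtain C where C: "0 < C" "\<And>t. 0 < t \<Longrightarrow>
    fundamental_function R p q b (ennreal t) \<le> ennreal (C * (t powr recip p * b t))"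
    using fundamental_function_upper_bound[OF R q b a] by metis
  \<comment> \<open>\<open>equiv_on\<close> demands ordered constants; comparing the two bounds at
    \<open>t = 1\<close> provides the order.\<close>
  have "c * (1 powr recip p * b 1) \<le> C * (1 powr recip p * b 1)"
    using order_trans[OF c(2)[of 1] C(2)[of 1]] C(1) slowly_varying_pos[OF b, of 1]
    by (simp add: ennreal_le_iff)
  then have cC: "c \<le> C"
    using slowly_varying_pos[OF b, of 1] by simp
  show "equiv_on {0<..} (\<lambda>t. ennreal (t powr recip p * b t))
      (\<lambda>t. fundamental_function R p q b (ennreal t))"
    unfolding equiv_on_def
  proof (rule exI[of _ c], rule exI[of _ C], intro conjI ballI)
    fix t :: real assume "t \<in> {0<..}"
    then show "ennreal c * ennreal (t powr recip p * b t) \<le> fundamental_function R p q b (ennreal t)"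
      "fundamental_function R p q b (ennreal t) \<le> ennreal C * ennreal (t powr recip p * b t)"
      using c C slowly_varying_pos[OF b, of t] by (simp_all add: ennreal_mult[symmetric])
  qed (use c cC in auto)
qed

text \<open>The lower bound applies to this single value for every \<open>t\<close>, and
  \<open>t powr recip p * b t\<close> is unbounded.\<close>

lemma fundamental_function_infinity:
  assumes R: "sigma_finite_measure R" "nonatomic R" "emeasure R (space R) = \<infinity>"
    and q: "0 < q" and b: "slowly_varying b" and a: "0 < recip p"
  shows "fundamental_function R p q b \<infinity> = \<infinity>"
proof (rule ccontr)
  assume "fundamental_function R p q b \<infinity> \<noteq> \<infinity>"
  then obtain y where y: "0 \<le> y" "fundamental_function R p q b \<infinity> = ennreal y"
    by (cases "fundamental_function R p q b \<infinity>") auto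
  obtain c where c: "0 < c" "\<And>t. 0 < t \<Longrightarrow>
    ennreal (c * (t powr recip p * b t)) \<le> fundamental_function R p q b \<infinity>"
    using fundamental_function_lower_bound[OF R q b less_imp_le[OF a]] by (metis infinity_ennreal_def top_greatest)
  obtain t where t: "1 \<le> t" "y / c < t powr recip p * b t"
    using slowly_varying_powr_unbounded[OF b a] by metis
  have "c * (t powr recip p * b t) \<le> y"
    using c(2)[of t] t(1) y by (simp add: ennreal_le_iff)
  with t(2) c(1) show False
    by (simp add: field_simps)
qed

section \<open>Incompatibility with quasi-concavity\<close>

lemma powr_slowly_varying_not_equiv_quasi_concave:
  assumes b: "slowly_varying b"
    and a: "1 < a \<or> (a = 1 \<and> \<not> (\<exists>g::real \<Rightarrow> ennreal. antimono_on {0<..} g \<and>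
                      equiv_on {0<..} (\<lambda>t. ennreal (b t)) g))"
    and \<psi>: "quasi_concave \<psi>"
  shows "\<not> equiv_on {0<..} (\<lambda>t. ennreal (t powr a * b t)) (\<lambda>t. ennreal (\<psi> t))"
proof
  assume eq: "equiv_on {0<..} (\<lambda>t. ennreal (t powr a * b t)) (\<lambda>t. ennreal (\<psi> t))"
  have pos: "0 < \<psi> t" if "0 < t" for t
    using \<psi> that unfolding quasi_concave_def by (metis less_eq_real_def less_irrefl)
  have decr: "\<psi> t / t \<le> \<psi> s / s" if "0 < s" "s \<le> t" for s t
  proof -
    have "s / \<psi> s \<le> t / \<psi> t"
      using \<psi> that unfolding quasi_concave_def monotone_on_def by auto
    then show ?thesis
      using that pos[of s] pos[of t] by (simp add: field_simps)
  qed
  obtain c C where c: "0 < c" "c \<le> C"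
    and le: "\<And>t. 0 < t \<Longrightarrow> c * (t powr a * b t) \<le> \<psi> t \<and> \<psi> t \<le> C * (t powr a * b t)"
    using eq pos slowly_varying_pos[OF b] by (subst (asm) equiv_on_ennreal_iff) (auto intro: less_imp_le)
  show False
    using a
  proof
    \<comment> \<open>From 1 on, \<open>\<psi> t / t\<close> stays below \<open>\<psi> 1\<close>,
      yet it dominates the unbounded \<open>c * (t powr (a - 1) * b t)\<close>.\<close>
    assume "1 < a"
    then obtain t where t: "1 \<le> t" "\<psi> 1 / c < t powr (a - 1) * b t"
      using slowly_varying_powr_unbounded[OF b, of "a - 1" "\<psi> 1 / c"] by auto
    have "c * (t powr (a - 1) * b t) = c * (t powr a * b t) / t"
      using t(1) by (simp add: powr_diff)
    also have "\<dots> \<le> \<psi> t / t"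
      using le[of t] t(1) by (intro divide_right_mono) auto
    also have "\<dots> \<le> \<psi> 1"
      using decr[of 1 t] t(1) by simp
    finally show False
      using t(2) c(1) by (simp add: field_simps)
  next
    assume *: "a = 1 \<and> \<not> (\<exists>g::real \<Rightarrow> ennreal. antimono_on {0<..} g \<and>
                      equiv_on {0<..} (\<lambda>t. ennreal (b t)) g)"
    \<comment> \<open>For \<open>a = 1\<close>, dividing the equivalence by \<open>t\<close>
      exhibits \<open>\<psi> t / t\<close> as a non-increasing function equivalent to
      \<open>b\<close>.\<close>
    have "antimono_on {0<..} (\<lambda>t. ennreal (\<psi> t / t))"
      using decr by (auto simp: monotone_on_def intro!: ennreal_leI)
    moreover have "equiv_on {0<..} (\<lambda>t. ennreal (b t)) (\<lambda>t. ennreal (\<psi> t / t))"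
    proof (subst equiv_on_ennreal_iff)
      show "\<exists>c C. 0 < c \<and> c \<le> C \<and> (\<forall>t\<in>{0<..}. c * b t \<le> \<psi> t / t \<and> \<psi> t / t \<le> C * b t)"
        using c le * by (intro exI[of _ c] exI[of _ C]) (auto simp: field_simps)
    qed (use pos slowly_varying_pos[OF b] in \<open>auto intro: less_imp_le\<close>)
    ultimately show False using * by blast
  qed
qed

theorem proposition3p10:
  fixes R :: "'a measure" and p q :: ennreal and b :: "real \<Rightarrow> real"
  assumes "sigma_finite_measure R" and "nonatomic R" and "emeasure R (space R) = \<infinity>"
    and "0 < p" and "0 < q" and "slowly_varying b"
    and "p < 1 \<or>
         (p = 1 \<and> \<not> (\<exists>g::real \<Rightarrow> ennreal. antimono_on {0<..} g \<and>
                      equiv_on {0<..} (\<lambda>t. ennreal (b t)) g))"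
  shows "equiv_on {0<..} (\<lambda>t. fundamental_function R p q b (ennreal t))
           (\<lambda>t. ennreal (t powr recip p * b t)) \<and>
         fundamental_function R p q b \<infinity> = \<infinity> \<and>
         \<not> (\<exists>\<psi>. quasi_concave \<psi> \<and>
              equiv_on {0<..} (\<lambda>t. fundamental_function R p q b (ennreal t))
                (\<lambda>t. ennreal (\<psi> t)))"
proof -
  have p1: "p \<le> 1" using assms(7) by auto
  then have pfin: "p \<noteq> \<infinity>" by (auto simp: top_unique)
  then have p: "p = ennreal (enn2real p)" "0 < enn2real p"
    using enn2real_pos[OF assms(4)] by (auto simp: less_top)
  have recip: "recip p = 1 / enn2real p" using pfin by (simp add: recip_def)
  then have a0: "0 < recip p" using p(2) by simp
  have a: "1 < recip p \<or> (recip p = 1 \<and> \<not> (\<exists>g::real \<Rightarrow> ennreal. antimono_on {0<..} g \<and>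
                      equiv_on {0<..} (\<lambda>t. ennreal (b t)) g))"
    using assms(7)
  proof (elim disjE)
    assume "p < 1"
    then have "enn2real p < 1"
      by (subst (asm) p(1)) (simp add: ennreal_less_iff flip: ennreal_1)
    then show ?thesis using p(2) by (simp add: recip)
  qed (auto simp: recip_def)
  have equiv: "equiv_on {0<..} (\<lambda>t. fundamental_function R p q b (ennreal t))
           (\<lambda>t. ennreal (t powr recip p * b t))"
    by (rule fundamental_function_equiv[OF assms(1-3,5,6) a0])
  \<comment> \<open>By transitivity, a quasi-concave function equivalent to the fundamental function
    would also be equivalent to \<open>t powr recip p * b t\<close>.\<close>
  show ?thesis
    using equiv fundamental_function_infinity[OF assms(1-3,5,6) a0]
      powr_slowly_varying_not_equiv_quasi_concave[OF assms(6) a]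
      equiv_on_trans[OF equiv_on_sym[OF equiv]]
    by blast
qed

end
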